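(* Let $\lambda$ be a nonzero real number. For integers $n,r\ge0$ let $S_n(x,r\mid\lambda)=\sum_{k=0}^{n}(-1)^k\binom{x}{k}(k)_{r,\lambda}$. Then for all integers $n,r\ge0$, $$ S_{n}(x,r\mid\lambda)=(-1)^{n}\sum_{j=0}^{r}\binom{x}{j}\binom{x-j-1}{n-j}j!{r \brace j}_{\lambda}. $$
   Context: For a real parameter $\mu$ the degenerate falling factorials are $(x)_{0,\mu}=1$ and $(x)_{n,\mu}=x(x-\mu)\cdots(x-(n-1)\mu)$ for $n\ge1$; $(x)_n=(x)_{n,1}$ is the usual falling factorial. Binomial coefficients are $\binom{y}{m}=(y)_m/m!$ for integers $m\ge0$ and $\binom{y}{m}=0$ for integers $m<0$. The degenerate Stirling numbers of the second kind ${n \brace k}_{\mu}$ are defined by $(x)_{n,\mu}=\sum_{k=0}^{n}{n \brace k}_{\mu}(x)_k$. *)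

theory Defs
  imports Complex_Main
begin

definition degen_ffact :: "real \<Rightarrow> nat \<Rightarrow> real \<Rightarrow> real" where
  "degen_ffact x n \<mu> = (\<Prod>i<n. x - real i * \<mu>)"

definition ffact :: "real \<Rightarrow> nat \<Rightarrow> real" where
  "ffact x n = degen_ffact x n 1"

definition binom :: "real \<Rightarrow> int \<Rightarrow> real" where
  "binom y m = (if m < 0 then 0 else y gchoose nat m)"

text \<open>The coefficients are normalised to vanish for \<open>k > n\<close>, which makes the sequence of
  coefficients in the defining expansion unique.\<close>

definition is_degen_stirling2_row :: "nat \<Rightarrow> real \<Rightarrow> (nat \<Rightarrow> real) \<Rightarrow> bool" where
  "is_degen_stirling2_row n \<mu> c \<longleftrightarrow>
     (\<forall>x. degen_ffact x n \<mu> = (\<Sum>k=0..n. c k * ffact x k)) \<and> (\<forall>k>n. c k = 0)"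

definition degen_stirling2 :: "nat \<Rightarrow> nat \<Rightarrow> real \<Rightarrow> real" where
  "degen_stirling2 n k \<mu> = (THE c. is_degen_stirling2_row n \<mu> c) k"

definition S_sum :: "nat \<Rightarrow> real \<Rightarrow> nat \<Rightarrow> real \<Rightarrow> real" where
  "S_sum n x r lam = (\<Sum>k=0..n. (-1) ^ k * binom x (int k) * degen_ffact (real k) r lam)"

lemma binom_eq_ffact: "binom y (int m) = ffact y m / fact m"
  by (simp add: binom_def ffact_def degen_ffact_def gbinomial_prod_rev atLeast0LessThan)

lemma ffact_Suc: "ffact x (Suc k) = ffact x k * (x - real k)"
  by (simp add: ffact_def degen_ffact_def)

lemma ffact_of_nat_eq_0: "m < k \<Longrightarrow> ffact (real m) k = 0"
  by (auto simp: ffact_def degen_ffact_def)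

lemma ffact_of_nat_self_neq_0: "ffact (real m) m \<noteq> 0"
  by (auto simp: ffact_def degen_ffact_def)

lemma is_degen_stirling2_row_exists: "\<exists>c. is_degen_stirling2_row n \<mu> c"
proof (induction n)
  case 0
  have "is_degen_stirling2_row 0 \<mu> (\<lambda>k. if k = 0 then 1 else 0)"
    by (simp add: is_degen_stirling2_row_def ffact_def degen_ffact_def)
  then show ?case by blast
next
  case (Suc n)
  then obtain c where c: "\<And>x. degen_ffact x n \<mu> = (\<Sum>k=0..n. c k * ffact x k)"
    and c0: "\<And>k. k > n \<Longrightarrow> c k = 0"
    by (auto simp: is_degen_stirling2_row_def)
  define d where
    "d k = (if k = 0 then 0 else c (k - 1)) + (real k - real n * \<mu>) * c k" for k
  have "degen_ffact x (Suc n) \<mu> = (\<Sum>k=0..Suc n. d k * ffact x k)" for x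
  proof -
    have "degen_ffact x (Suc n) \<mu> = (\<Sum>k=0..n. c k * ffact x k) * (x - real n * \<mu>)"
      by (simp add: degen_ffact_def flip: c)
    also have "\<dots> = (\<Sum>k=0..n. c k * ffact x (Suc k) + (real k - real n * \<mu>) * c k * ffact x k)"
      unfolding sum_distrib_right by (intro sum.cong) (auto simp: ffact_Suc algebra_simps)
    also have "\<dots> = (\<Sum>k=0..n. c k * ffact x (Suc k))
        + (\<Sum>k=0..Suc n. (real k - real n * \<mu>) * c k * ffact x k)"
      by (simp add: sum.distrib c0)
    also have "(\<Sum>k=0..n. c k * ffact x (Suc k))
        = (\<Sum>k=0..Suc n. (if k = 0 then 0 else c (k - 1)) * ffact x k)"
      by (subst sum.atLeast0_atMost_Suc_shift) simp
    finally show ?thesis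
      by (simp only: d_def distrib_right sum.distrib)
  qed
  moreover have "\<forall>k>Suc n. d k = 0"
    by (auto simp: d_def c0)
  ultimately show ?case
    unfolding is_degen_stirling2_row_def by blast
qed

lemma is_degen_stirling2_row_unique:
  assumes "is_degen_stirling2_row n \<mu> c" "is_degen_stirling2_row n \<mu> d"
  shows "c = d"
proof
  fix k
  show "c k = d k"
  proof (induction k rule: less_induct)
    case (less k)
    show ?case
    proof (cases "k \<le> n")
      case False
      then show ?thesis using assms by (auto simp: is_degen_stirling2_row_def)
    next
      case True
      have "(\<Sum>i=0..n. (c i - d i) * ffact (real k) i) = 0"
        using assms by (simp add: is_degen_stirling2_row_def left_diff_distrib sum_subtractf)
      also have "(\<Sum>i=0..n. (c i - d i) * ffact (real k) i)
          = (\<Sum>i\<in>{k}. (c i - d i) * ffact (real k) i)"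
      proof (rule sum.mono_neutral_right)
        show "\<forall>i\<in>{0..n} - {k}. (c i - d i) * ffact (real k) i = 0"
        proof
          fix i assume "i \<in> {0..n} - {k}"
          then consider "i < k" | "k < i" by fastforce
          then show "(c i - d i) * ffact (real k) i = 0"
            by cases (simp_all add: less ffact_of_nat_eq_0)
        qed
      qed (use True in auto)
      finally show ?thesis using ffact_of_nat_self_neq_0[of k] by simp
    qed
  qed
qed

lemma is_degen_stirling2_row_degen_stirling2:
  "is_degen_stirling2_row n \<mu> (\<lambda>k. degen_stirling2 n k \<mu>)"
proof -
  have "\<exists>!c. is_degen_stirling2_row n \<mu> c"
    by (rule ex_ex1I[OF is_degen_stirling2_row_exists is_degen_stirling2_row_unique])
  then have "is_degen_stirling2_row n \<mu> (THE c. is_degen_stirling2_row n \<mu> c)"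
    by (rule theI')
  then show ?thesis by (simp add: degen_stirling2_def)
qed

end

theory Submission
  imports Defs
begin

text \<open>Expand \<open>(k)\<^sub>r\<^sub>,\<^sub>\<lambda>\<close> in ordinary falling factorials and exchange the sums. By trinomial
  revision \<open>binom x k * (k)\<^sub>j = j! * binom x j * binom (x - j) (k - j)\<close>, so the inner sum over \<open>k\<close> is
  an alternating partial row sum of binomial coefficients, which telescopes.\<close>

lemma binom_mult_ffact:
  assumes "j \<le> k"
  shows "binom x (int k) * ffact (real k) j
           = fact j * binom x (int j) * ((x - real j) gchoose (k - j))"
proof -
  have "ffact (real k) j = fact j * (real k gchoose j)"
    using binom_eq_ffact[of "real k" j] by (simp add: binom_def field_simps)
  then show ?thesis
    using gbinomial_trinomial_revision[OF assms, of x] by (simp add: binom_def)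
qed

text \<open>Gives the factor multiplying \<open>degen_stirling2 r j lam\<close> once the sums are
  exchanged; \<open>lam\<close> no longer enters.\<close>

lemma alternating_sum_binom_ffact:
  "(\<Sum>k=0..n. (-1) ^ k * binom x (int k) * ffact (real k) j)
     = (-1) ^ n * (fact j * binom x (int j) * binom (x - real j - 1) (int n - int j))"
proof (cases "j \<le> n")
  case False
  \<comment> \<open>Both sides vanish: each \<open>k \<le> n < j\<close> makes
    \<open>ffact (real k) j\<close> zero, and \<open>int n - int j\<close> is negative.\<close>
  then show ?thesis
    by (simp add: binom_def ffact_of_nat_eq_0)
next
  case True
  have "(\<Sum>k=0..n. (-1) ^ k * binom x (int k) * ffact (real k) j)
      = (\<Sum>k=j..n. (-1) ^ k * binom x (int k) * ffact (real k) j)"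
    by (rule sum.mono_neutral_right) (auto simp: ffact_of_nat_eq_0)
  also have "\<dots> = (\<Sum>i\<le>n - j. (-1) ^ (i + j) * binom x (int (i + j)) * ffact (real (i + j)) j)"
    using True by (intro sum.reindex_bij_witness[of _ "\<lambda>i. i + j" "\<lambda>k. k - j"]) auto
  also have "\<dots> = (\<Sum>i\<le>n - j. (-1) ^ j * fact j * binom x (int j)
      * (((x - real j) gchoose i) * (-1) ^ i))"
  proof (rule sum.cong)
    fix i
    show "(-1) ^ (i + j) * binom x (int (i + j)) * ffact (real (i + j)) j
        = (-1) ^ j * fact j * binom x (int j) * (((x - real j) gchoose i) * (-1) ^ i)"
      using binom_mult_ffact[of j "i + j" x] by (simp add: power_add mult.assoc)
  qed simp
  \<comment> \<open>By Pascal's rule the alternating partial sum of row \<open>x - real j\<close>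
    telescopes to one signed entry of the row above; hence the shift to
    \<open>x - real j - 1\<close>.\<close>
  also have "\<dots> = (-1) ^ j * fact j * binom x (int j)
      * ((-1) ^ (n - j) * ((x - real j - 1) gchoose (n - j)))"
    by (simp only: gbinomial_sum_lower_neg flip: sum_distrib_left)
  also have "\<dots> = (-1) ^ (j + (n - j))
      * (fact j * binom x (int j) * ((x - real j - 1) gchoose (n - j)))"
    by (simp only: power_add mult_ac)
  finally show ?thesis
    using True by (simp add: binom_def nat_diff_distrib)
qed

theorem theorem2p9:
  fixes lam x :: real and n r :: nat
  assumes "lam \<noteq> 0"
  shows "S_sum n x r lam = (-1) ^ n * (\<Sum>j=0..r. binom x (int j)
           * binom (x - real j - 1) (int n - int j) * fact j * degen_stirling2 r j lam)"
proof -
  \<comment> \<open>Existence and uniqueness of the row make the \<open>THE\<close> in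
    \<open>degen_stirling2\<close> satisfy its defining expansion, used below at
    \<open>y = real k\<close>.\<close>
  have "degen_ffact y r lam = (\<Sum>j=0..r. degen_stirling2 r j lam * ffact y j)" for y
    using is_degen_stirling2_row_degen_stirling2 by (simp add: is_degen_stirling2_row_def)
  then have "S_sum n x r lam = (\<Sum>k=0..n. \<Sum>j=0..r.
      degen_stirling2 r j lam * ((-1) ^ k * binom x (int k) * ffact (real k) j))"
    by (simp add: S_sum_def sum_distrib_left mult_ac)
  also have "\<dots> = (\<Sum>j=0..r. degen_stirling2 r j lam
      * (\<Sum>k=0..n. (-1) ^ k * binom x (int k) * ffact (real k) j))"
    unfolding sum_distrib_left by (rule sum.swap)
  finally show ?thesis
    unfolding alternating_sum_binom_ffact by (simp add: sum_distrib_left mult_ac)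
qed

end
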